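(* For each positive integer $e$ divisible by $3$ there is a regular map in class III whose automorphism group is isomorphic to $L_2(2^e)=SL_2(\mathbb{F}_{2^e})$. (Equivalently: there is a normal subgroup $M$ of $\Gamma$ with $\Gamma/M\cong L_2(2^e)$ that is invariant under $\Sigma^+$ but not under $\Sigma$.)
   Context: Let $\Gamma=\langle R_0,R_1,R_2\mid R_0^2=R_1^2=R_2^2=(R_0R_2)^2=1\rangle$, the free product of the Klein four-group $V=\langle R_0,R_2\rangle$ and $C=\langle R_1\rangle\cong C_2$. Regular maps $\mathcal M$ on surfaces, up to isomorphism, are identified with normal subgroups $M$ of $\Gamma$ (the map subgroups), with $\mathrm{Aut}\,\mathcal M\cong\Gamma/M$; maps are without boundary and without free edges, i.e. $M$ contains no conjugate of $R_0$, $R_1$, $R_2$ or $R_0R_2$. Isomorphic regular maps have the same map subgroup. Let $\Sigma\cong S_3$ be the group of the six automorphisms of $\Gamma$ that fix $R_1$ and permute the three involutions $R_0,R_2,R_0R_2$ of $V$. It acts on the normal subgroups of $\Gamma$, hence on regular maps; this is Wilson's group of map operations. Let $\Sigma^+\cong C_3$ be its subgroup of order $3$ (the identity and the two trialities, inducing the $3$-cycles on $R_0,R_2,R_0R_2$). A regular map with map subgroup $M$ is in class III if its $\Sigma$-orbit has exactly two elements, i.e. $M$ is invariant under $\Sigma^+$ but not under $\Sigma$. *)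

theory Defs
  imports
    "HOL-Analysis.Determinants"
    "HOL-Algebra.Bij"
    "HOL-Algebra.Algebraic_Closure_Type"
begin

section \<open>Groups given by generators and relators\<close>

text \<open>The letter \<open>(g, True)\<close> stands for the generator \<open>g\<close>, the letter \<open>(g, False)\<close> for its inverse.\<close>

type_synonym 'g word = "('g \<times> bool) list"

inductive pres_eq :: "'g word set \<Rightarrow> 'g word \<Rightarrow> 'g word \<Rightarrow> bool" for Rels where
  refl: "pres_eq Rels u u"
| sym: "pres_eq Rels u v \<Longrightarrow> pres_eq Rels v u"
| trans: "pres_eq Rels u v \<Longrightarrow> pres_eq Rels v w \<Longrightarrow> pres_eq Rels u w"
| append: "pres_eq Rels u u' \<Longrightarrow> pres_eq Rels v v' \<Longrightarrow> pres_eq Rels (u @ v) (u' @ v')"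
| cancel: "pres_eq Rels [(g, b), (g, \<not> b)] []"
| relator: "r \<in> Rels \<Longrightarrow> pres_eq Rels r []"

definition pres_rel :: "'g word set \<Rightarrow> ('g word \<times> 'g word) set" where
  "pres_rel Rels = {(u, v). pres_eq Rels u v}"

definition presented_group :: "'g word set \<Rightarrow> 'g word set monoid" where
  "presented_group Rels =
     \<lparr>carrier = UNIV // pres_rel Rels,
      mult = (\<lambda>A B. \<Union>a\<in>A. \<Union>b\<in>B. pres_rel Rels `` {a @ b}),
      one = pres_rel Rels `` {[]}\<rparr>"

lemma equiv_pres_rel: "equiv UNIV (pres_rel Rels)"
  by (rule equivI)
     (auto simp: pres_rel_def refl_on_def sym_def trans_def
           intro: pres_eq.refl pres_eq.sym pres_eq.trans)

lemma presented_group_mult: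
  "(pres_rel Rels `` {u}) \<otimes>\<^bsub>presented_group Rels\<^esub> (pres_rel Rels `` {v})
     = pres_rel Rels `` {u @ v}"
proof -
  have "congruent2 (pres_rel Rels) (pres_rel Rels) (\<lambda>a b. pres_rel Rels `` {a @ b})"
    unfolding congruent2_def
  proof clarify
    fix a a' b b'
    assume "(a, a') \<in> pres_rel Rels" "(b, b') \<in> pres_rel Rels"
    then have "(a @ b, a' @ b') \<in> pres_rel Rels"
      by (simp add: pres_rel_def pres_eq.append)
    then show "pres_rel Rels `` {a @ b} = pres_rel Rels `` {a' @ b'}"
      by (rule equiv_class_eq[OF equiv_pres_rel])
  qed
  from UN_equiv_class2[OF equiv_pres_rel equiv_pres_rel this]
  show ?thesis by (simp add: presented_group_def)
qed

lemma pres_eq_inverse: "pres_eq Rels (rev (map (\<lambda>(g, b). (g, \<not> b)) u) @ u) []"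
proof (induction u)
  case Nil
  show ?case by (simp add: pres_eq.refl)
next
  case (Cons x u)
  obtain g b where x: "x = (g, b)" by fastforce
  let ?u = "rev (map (\<lambda>(g, b). (g, \<not> b)) u)"
  have "pres_eq Rels [(g, \<not> b), (g, b)] []"
    using pres_eq.cancel[of Rels g "\<not> b"] by simp
  then have "pres_eq Rels (?u @ ([(g, \<not> b), (g, b)] @ u)) (?u @ ([] @ u))"
    by (intro pres_eq.append pres_eq.refl)
  then have "pres_eq Rels (?u @ ([(g, \<not> b), (g, b)] @ u)) []"
    using Cons.IH pres_eq.trans by fastforce
  then show ?case by (simp add: x)
qed

lemma group_presented_group: "group (presented_group Rels)"
proof (rule groupI)
  let ?G = "presented_group Rels"
  have cls: "\<exists>u. A = pres_rel Rels `` {u}" if "A \<in> carrier ?G" for A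
    using that by (auto simp: presented_group_def quotient_def)
  have mem: "pres_rel Rels `` {u} \<in> carrier ?G" for u
    by (auto simp: presented_group_def quotient_def)
  have one: "\<one>\<^bsub>?G\<^esub> = pres_rel Rels `` {[]}"
    by (simp add: presented_group_def)
  show "\<one>\<^bsub>?G\<^esub> \<in> carrier ?G"
    using mem one by simp
  show "A \<otimes>\<^bsub>?G\<^esub> B \<in> carrier ?G" if "A \<in> carrier ?G" "B \<in> carrier ?G" for A B
    using cls[OF that(1)] cls[OF that(2)] mem by (auto simp: presented_group_mult)
  show "A \<otimes>\<^bsub>?G\<^esub> B \<otimes>\<^bsub>?G\<^esub> C = A \<otimes>\<^bsub>?G\<^esub> (B \<otimes>\<^bsub>?G\<^esub> C)"
    if "A \<in> carrier ?G" "B \<in> carrier ?G" "C \<in> carrier ?G" for A B C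
    using cls[OF that(1)] cls[OF that(2)] cls[OF that(3)] by (auto simp: presented_group_mult)
  show "\<one>\<^bsub>?G\<^esub> \<otimes>\<^bsub>?G\<^esub> A = A" if "A \<in> carrier ?G" for A
    using cls[OF that] by (auto simp: one presented_group_mult)
  show "\<exists>B\<in>carrier ?G. B \<otimes>\<^bsub>?G\<^esub> A = \<one>\<^bsub>?G\<^esub>" if A: "A \<in> carrier ?G" for A
  proof -
    obtain u where u: "A = pres_rel Rels `` {u}" using cls[OF A] by blast
    let ?v = "rev (map (\<lambda>(g, b). (g, \<not> b)) u)"
    have "(pres_rel Rels `` {?v}) \<otimes>\<^bsub>?G\<^esub> A = \<one>\<^bsub>?G\<^esub>"
      unfolding u one presented_group_mult
      by (rule equiv_class_eq[OF equiv_pres_rel]) (simp add: pres_rel_def pres_eq_inverse)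
    then show ?thesis using mem by blast
  qed
qed


section \<open>The group \<open>\<Gamma>\<close> and map subgroups\<close>

datatype gamma_gen = G0 | G1 | G2

definition gamma_relators :: "gamma_gen word set" where
  "gamma_relators =
     {[(G0, True), (G0, True)],
      [(G1, True), (G1, True)],
      [(G2, True), (G2, True)],
      [(G0, True), (G2, True), (G0, True), (G2, True)]}"

definition Gamma :: "gamma_gen word set monoid" where
  "Gamma = presented_group gamma_relators"

definition gamma_class :: "gamma_gen \<Rightarrow> gamma_gen word set" where
  "gamma_class g = pres_rel gamma_relators `` {[(g, True)]}"

abbreviation R0 :: "gamma_gen word set" where "R0 \<equiv> gamma_class G0"
abbreviation R1 :: "gamma_gen word set" where "R1 \<equiv> gamma_class G1"
abbreviation R2 :: "gamma_gen word set" where "R2 \<equiv> gamma_class G2"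
abbreviation R02 :: "gamma_gen word set" where "R02 \<equiv> R0 \<otimes>\<^bsub>Gamma\<^esub> R2"

text \<open>
  Regular maps without boundary and without free edges, up to isomorphism, are represented by
  their map subgroups; the automorphism group of the map is the quotient by the map subgroup.
\<close>

definition regular_map_subgroup :: "gamma_gen word set set \<Rightarrow> bool" where
  "regular_map_subgroup M \<longleftrightarrow>
     M \<lhd> Gamma \<and>
     (\<forall>x\<in>carrier Gamma. \<forall>r\<in>{R0, R1, R2, R02}. x \<otimes>\<^bsub>Gamma\<^esub> r \<otimes>\<^bsub>Gamma\<^esub> inv\<^bsub>Gamma\<^esub> x \<notin> M)"

definition map_automorphism_group :: "gamma_gen word set set \<Rightarrow> gamma_gen word set set monoid" where
  "map_automorphism_group M = Gamma Mod M"


section \<open>Wilson's operations\<close>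

definition Sigma_ops :: "(gamma_gen word set \<Rightarrow> gamma_gen word set) set" where
  "Sigma_ops = {\<sigma> \<in> auto Gamma. \<sigma> R1 = R1 \<and> \<sigma> ` {R0, R2, R02} = {R0, R2, R02}}"

definition map_orbit :: "gamma_gen word set set \<Rightarrow> gamma_gen word set set set" where
  "map_orbit M = (\<lambda>\<sigma>. \<sigma> ` M) ` Sigma_ops"

definition class_III :: "gamma_gen word set set \<Rightarrow> bool" where
  "class_III M \<longleftrightarrow> regular_map_subgroup M \<and> card (map_orbit M) = 2"


section \<open>Special linear groups over finite fields of characteristic two\<close>

text \<open>
  The subfield of order \<open>2 ^ e\<close> (for \<open>e > 0\<close>) of an algebraic closure of the prime field; see
  \<open>GF_2_pow_subfield\<close> and \<open>card_GF_2_pow\<close> below.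
\<close>

definition GF_2_pow :: "nat \<Rightarrow> gf2 alg_closure set" where
  "GF_2_pow e = {x. x ^ (2 ^ e) = x}"

definition SL2 :: "'a::field set \<Rightarrow> ('a ^ 2 ^ 2) monoid" where
  "SL2 K = \<lparr>carrier = {A. (\<forall>i j. A $ i $ j \<in> K) \<and> det A = 1}, mult = (**), one = mat 1\<rparr>"

lemma CHAR_gf2: "CHAR(gf2) = 2"
proof (rule CHAR_eqI)
  show *: "of_nat 2 = (0 :: gf2)"
  proof -
    have "(1 :: gf2) + 1 = 0" by transfer simp
    then show ?thesis by simp
  qed
  show "2 dvd n" if n: "of_nat n = (0 :: gf2)" for n
  proof (rule ccontr)
    assume "\<not> 2 dvd n"
    then obtain k where k: "n = 2 * k + 1" by (metis oddE)
    have "of_nat n = of_nat 2 * of_nat k + (1 :: gf2)" unfolding k by simp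
    with n * show False by simp
  qed
qed

lemma GF_2_pow_subfield:
  "0 \<in> GF_2_pow e" "1 \<in> GF_2_pow e"
  "x \<in> GF_2_pow e \<Longrightarrow> y \<in> GF_2_pow e \<Longrightarrow> x + y \<in> GF_2_pow e"
  "x \<in> GF_2_pow e \<Longrightarrow> y \<in> GF_2_pow e \<Longrightarrow> x * y \<in> GF_2_pow e"
  "x \<in> GF_2_pow e \<Longrightarrow> - x \<in> GF_2_pow e"
  "x \<in> GF_2_pow e \<Longrightarrow> inverse x \<in> GF_2_pow e"
proof -
  have C: "CHAR(gf2 alg_closure) = 2"
    by (simp add: CHAR_gf2)
  show "0 \<in> GF_2_pow e" "1 \<in> GF_2_pow e"
    by (simp_all add: GF_2_pow_def)
  show "x + y \<in> GF_2_pow e" if "x \<in> GF_2_pow e" "y \<in> GF_2_pow e"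
    using that freshmans_dream'[where ?'a = "gf2 alg_closure", of "2 ^ e" e x y] C
    by (simp add: GF_2_pow_def)
  show "x * y \<in> GF_2_pow e" if "x \<in> GF_2_pow e" "y \<in> GF_2_pow e"
    using that by (simp add: GF_2_pow_def power_mult_distrib)
  show "- x \<in> GF_2_pow e" if "x \<in> GF_2_pow e"
    using that C by (simp add: uminus_CHAR_2)
  show "inverse x \<in> GF_2_pow e" if "x \<in> GF_2_pow e"
    using that by (simp add: GF_2_pow_def power_inverse)
qed

lemma card_GF_2_pow:
  assumes "e > 0"
  shows "card (GF_2_pow e) = 2 ^ e"
proof -
  define q :: nat where "q = 2 ^ e"
  define p :: "gf2 alg_closure poly" where "p = Polynomial.monom 1 q - [:0, 1:]"
  have q: "q > 1" using assms one_less_power[of "2 :: nat" e] by (simp add: q_def)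
  have "of_nat q = (0 :: gf2 alg_closure)"
    unfolding of_nat_eq_0_iff_char_dvd using assms by (simp add: CHAR_gf2 q_def)
  then have der: "pderiv p = - 1"
    by (simp add: p_def pderiv_diff pderiv_monom pderiv_pCons one_pCons)
  have deg: "Polynomial.degree p = q"
  proof -
    have "p = Polynomial.monom 1 q + (- [:0, 1:])" by (simp add: p_def)
    then show ?thesis
      using q by (simp add: Polynomial.degree_add_eq_left Polynomial.degree_monom_eq)
  qed
  then have "p \<noteq> 0" using q by auto
  then obtain A where A: "size A = Polynomial.degree p"
      "p = Polynomial.smult (Polynomial.lead_coeff p) (\<Prod>x\<in>#A. [:- x, 1:])"
    using alg_closed_imp_factorization by blast
  have lc: "Polynomial.lead_coeff p \<noteq> 0" using \<open>p \<noteq> 0\<close> by simp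
  have roots: "set_mset A = GF_2_pow e"
  proof -
    have "poly p x = 0 \<longleftrightarrow> x \<in># A" for x
      by (subst A(2)) (use lc in \<open>auto simp: poly_prod_mset prod_mset_zero_iff\<close>)
    then show ?thesis
      by (auto simp: p_def GF_2_pow_def q_def poly_monom)
  qed
  have cnt: "count A x \<le> 1" for x
  proof (rule ccontr)
    assume "\<not> count A x \<le> 1"
    then have "{#x, x#} \<subseteq># A"
      by (simp add: subseteq_mset_def)
    then obtain B where B: "A = {#x, x#} + B" by (metis subset_mset.le_iff_add)
    define r where "r = Polynomial.smult (Polynomial.lead_coeff p) (\<Prod>x\<in>#B. [:- x, 1:])"
    have "p = [:- x, 1:] * ([:- x, 1:] * r)"
      by (subst A(2)) (simp add: B r_def mult_ac)
    then have "poly (pderiv p) x = 0"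
      by (simp add: pderiv_mult del: mult_pCons_left)
    with der show False by simp
  qed
  have "card (set_mset A) = size A"
    unfolding size_multiset_overloaded_eq
    using cnt by (metis (no_types, lifting) card_eq_sum sum.cong count_greater_eq_one_iff le_antisym)
  with roots A(1) deg show ?thesis by (simp add: q_def)
qed

end

theory Submission
  imports Defs
begin

text \<open>
  Let \<open>e = 3 m\<close>, and let \<open>\<theta>\<close> be the field automorphism \<open>x \<mapsto> x ^ 2 ^ m\<close> of order three of the field
  with \<open>2 ^ e\<close> elements. Counting shows that some \<open>a = y + \<theta> y\<close> lies in no proper subfield; it
  satisfies \<open>a + \<theta> a + \<theta> (\<theta> a) = 0\<close>. Put \<open>b = \<theta> a\<close> and send \<open>R0\<close>, \<open>R2\<close> to the transvections
  with entries \<open>a\<close>, \<open>b\<close>, and \<open>R1\<close> to the matrix swapping the two basis vectors. Applying \<open>\<theta>\<close> to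
  matrix entries then permutes the images of \<open>R0\<close>, \<open>R2\<close>, \<open>R0 R2\<close> cyclically and fixes that of \<open>R1\<close>.

  Surjectivity is proved without Dickson's classification of subgroups: an element of nonzero trace
  has its square root among its powers, and such square roots of products of two involutions show that
  \<open>{x. upper x \<in> H}\<close> is a subfield containing \<open>a\<close>.

  An endomorphism exchanging the images of \<open>R0\<close> and \<open>R2\<close> and fixing that of \<open>R1\<close> would act on
  upper unipotent matrices by a map \<open>\<phi>\<close> that exchanges \<open>a\<close> and \<open>b\<close> and commutes with squaring
  nonzero elements, hence satisfies \<open>a = \<phi> b = \<theta> (\<phi> a) = \<theta> b = a + b\<close>, which is absurd.
\<close>

section \<open>Characteristic two and two-by-two matrices\<close>

type_synonym gf2bar = "gf2 alg_closure"

lemma CHAR_gf2bar: "CHAR(gf2bar) = 2"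
  by (simp add: CHAR_gf2)

lemma gf2bar_two [simp]: "(2 :: gf2bar) = 0"
proof -
  have "of_nat 2 = (0 :: gf2bar)"
    unfolding of_nat_eq_0_iff_char_dvd CHAR_gf2bar by simp
  then show ?thesis by simp
qed

text \<open>As simplification rules, this lemma and the next remove all minus signs; determinants
  therefore appear below as \<open>p * s + q * r\<close>.\<close>

lemma gf2bar_uminus [simp]: "- x = (x :: gf2bar)"
  by (simp add: uminus_CHAR_2 CHAR_gf2)

lemma gf2bar_diff [simp]: "x - y = (x :: gf2bar) + y"
  by (metis gf2bar_uminus diff_conv_add_uminus)

lemma gf2bar_add_self [simp]: "x + x = (0 :: gf2bar)" "x + (x + y) = (y :: gf2bar)"
  by (metis gf2bar_diff diff_self, metis gf2bar_diff diff_self add.assoc add_0)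

lemma gf2bar_add_eq_0: "x + y = (0 :: gf2bar) \<longleftrightarrow> x = y"
  by (metis gf2bar_add_self(1) add_left_cancel)

lemma gf2bar_add_pow: "(x + y) ^ (2 ^ k) = x ^ (2 ^ k) + (y :: gf2bar) ^ (2 ^ k)"
  using freshmans_dream'[where ?'a = gf2bar, of "2 ^ k" k x y] by (simp add: CHAR_gf2)

lemma gf2bar_sum_pow: "sum f S ^ (2 ^ k) = (\<Sum>i\<in>S. (f i :: gf2bar) ^ (2 ^ k))"
  by (induction S rule: infinite_finite_induct) (simp_all add: gf2bar_add_pow)

lemma gf2bar_square_inj: "x ^ 2 = (y :: gf2bar) ^ 2 \<longleftrightarrow> x = y"
  using gf2bar_add_pow[of x y 1] gf2bar_add_eq_0[of "x ^ 2" "y ^ 2"] gf2bar_add_eq_0[of x y]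
  by auto

lemma GF_2_pow_sqrt:
  assumes "e > 0" "x \<in> GF_2_pow e"
  obtains r where "r \<in> GF_2_pow e" "x = r ^ 2"
proof
  show "x ^ 2 ^ (e - 1) \<in> GF_2_pow e"
    using assms(2) by (simp add: GF_2_pow_def flip: power_mult) (simp add: mult.commute power_mult)
  show "x = (x ^ 2 ^ (e - 1)) ^ 2"
    using assms by (simp add: GF_2_pow_def flip: power_mult power_Suc2)
qed

lemma GF_2_pow_divide: "x \<in> GF_2_pow e \<Longrightarrow> y \<in> GF_2_pow e \<Longrightarrow> x / y \<in> GF_2_pow e"
  by (simp add: divide_inverse GF_2_pow_subfield)

lemma GF_2_pow_power: "x \<in> GF_2_pow e \<Longrightarrow> x ^ k \<in> GF_2_pow e"
  by (induction k) (simp_all add: GF_2_pow_subfield)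

lemma finite_GF_2_pow: "e > 0 \<Longrightarrow> finite (GF_2_pow e)"
  using card_GF_2_pow[of e] by (intro card_ge_0_finite) simp

section \<open>Explicit two-by-two matrices and square roots in \<open>SL2\<close>\<close>

definition mat2 :: "'a \<Rightarrow> 'a \<Rightarrow> 'a \<Rightarrow> 'a \<Rightarrow> ('a :: zero) ^ 2 ^ 2" where
  "mat2 p q r s = vector [vector [p, q], vector [r, s]]"

abbreviation upper :: "'a :: field \<Rightarrow> 'a ^ 2 ^ 2" where "upper x \<equiv> mat2 1 x 0 1"
abbreviation lower :: "'a :: field \<Rightarrow> 'a ^ 2 ^ 2" where "lower x \<equiv> mat2 1 0 x 1"
abbreviation swap_mat :: "'a :: field ^ 2 ^ 2" where "swap_mat \<equiv> mat2 0 1 1 0"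

lemma mat2_eq_iff [simp]: "mat2 p q r s = mat2 p' q' r' s' \<longleftrightarrow> p = p' \<and> q = q' \<and> r = r' \<and> s = s'"
  by (auto simp: mat2_def vec_eq_iff forall_2)

lemma mat2_cases:
  obtains p q r s where "A = mat2 p q r s"
proof
  let ?a = "\<lambda>i. vec_nth (vec_nth A i)"
  show "A = mat2 (?a 1 1) (?a 1 2) (?a 2 1) (?a 2 2)"
    by (simp add: mat2_def vec_eq_iff forall_2)
qed

lemma mat2_mult [simp]:
  "mat2 p q r s ** mat2 p' q' r' s' =
     mat2 (p * p' + q * r') (p * q' + q * s') (r * p' + s * r') (r * q' + s * (s' :: 'a :: semiring_1))"
  by (simp add: mat2_def matrix_matrix_mult_def vec_eq_iff forall_2 sum_2)

lemma mat_1_mat2: "mat 1 = mat2 1 0 0 (1 :: 'a :: field)"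
  by (simp add: mat2_def mat_def vec_eq_iff forall_2)

lemma det_mat2: "det (mat2 p q r s) = p * s - q * (r :: 'a :: comm_ring_1)"
  by (simp add: mat2_def det_2)

lemma mat2_in_SL2: "mat2 p q r s \<in> carrier (SL2 F) \<longleftrightarrow>
    p \<in> F \<and> q \<in> F \<and> r \<in> F \<and> s \<in> F \<and> p * s - q * r = 1"
  by (auto simp: SL2_def mat2_def det_2 forall_2)

lemma SL2_mult [simp]: "A \<otimes>\<^bsub>SL2 F\<^esub> B = A ** B"
  and SL2_one [simp]: "\<one>\<^bsub>SL2 F\<^esub> = mat 1"
  by (simp_all add: SL2_def)

lemma group_SL2_GF: "group (SL2 (GF_2_pow e))"
proof (rule groupI)
  let ?G = "SL2 (GF_2_pow e)"
  show "A \<otimes>\<^bsub>?G\<^esub> B \<in> carrier ?G" if "A \<in> carrier ?G" "B \<in> carrier ?G" for A B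
  proof -
    obtain p q r s p' q' r' s' where AB: "A = mat2 p q r s" "B = mat2 p' q' r' s'"
      by (metis mat2_cases)
    have "det (A ** B) = 1"
      using that by (simp add: det_mul SL2_def)
    then show ?thesis
      using that unfolding AB by (auto simp: mat2_in_SL2 det_mat2 intro!: GF_2_pow_subfield)
  qed
  show "\<one>\<^bsub>?G\<^esub> \<in> carrier ?G"
    by (simp add: mat_1_mat2 mat2_in_SL2 GF_2_pow_subfield)
  show "\<exists>B\<in>carrier ?G. B \<otimes>\<^bsub>?G\<^esub> A = \<one>\<^bsub>?G\<^esub>" if A: "A \<in> carrier ?G" for A
  proof -
    obtain p q r s where *: "A = mat2 p q r s" by (rule mat2_cases)
    show ?thesis
      using A unfolding *
      by (intro bexI[of _ "mat2 s q r p"]) (auto simp: mat2_in_SL2 mat_1_mat2 algebra_simps)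
  qed
qed (simp_all add: matrix_mul_assoc)

text \<open>For \<open>d = mat2 p q r s\<close>, Cayley--Hamilton gives d^2 = t^2 d + 1, hence (d +
  1)^2 = t^2 d in characteristic two, so the matrix in the conclusion squares to d. As
  \<open>H\<close> is only known to be closed under products, this root is found among the powers of
  d.\<close>

lemma SL2_sqrt_mem:
  fixes H :: "(gf2bar ^ 2 ^ 2) set"
  assumes H: "\<And>A B. A \<in> H \<Longrightarrow> B \<in> H \<Longrightarrow> A ** B \<in> H" "\<And>A. A \<in> H \<Longrightarrow> det A = 1"
    and d: "mat2 p q r s \<in> H" and t: "p + s = t ^ 2" "t \<noteq> 0" "t \<in> GF_2_pow e" "e > 0"
  shows "mat2 ((p + 1) / t) (q / t) (r / t) ((s + 1) / t) \<in> H"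
proof -
  have det: "p * s + q * r = 1"
    using H(2)[OF d] by (simp add: det_mat2)
  have s: "s = p + t ^ 2"
    using t(1) by (metis gf2bar_add_self(2))
  have qr: "q * r = 1 + p * (p + t ^ 2)"
    using det unfolding s by (metis add.commute gf2bar_add_self(2))
  \<comment> \<open>Closed form of the coefficient of d under repeated squaring, which starts at 1
    and obeys \<open>\<alpha> (Suc k) = (\<alpha> k) ^ 2 * t ^ 2\<close>.\<close>
  define \<alpha> where "\<alpha> k = (t ^ 2) ^ 2 ^ k / t ^ 2" for k :: nat
  have \<alpha>: "\<alpha> (Suc k) = (\<alpha> k) ^ 2 * t ^ 2" for k
  proof -
    have "(t ^ 2) ^ 2 ^ Suc k = ((t ^ 2) ^ 2 ^ k) ^ 2"
      by (simp add: mult.commute flip: power_mult)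
    then show ?thesis
      using t(2) by (simp add: \<alpha>_def power_divide power2_eq_square)
  qed
  \<comment> \<open>By Cayley--Hamilton, the power \<open>2 ^ k\<close> of \<open>d = mat2 p q r s\<close> has the form \<open>\<alpha> k \<cdot> d + c\<close>. For
    \<open>k = e - 1\<close> it turns out to be the square root of \<open>d\<close> or its inverse.\<close>
  have "\<exists>c. mat2 (\<alpha> k * p + c) (\<alpha> k * q) (\<alpha> k * r) (\<alpha> k * s + c) \<in> H" for k
  proof (induction k)
    case 0
    show ?case
      using d by (intro exI[of _ 0]) (use t(2) in \<open>simp add: \<alpha>_def\<close>)
  next
    case (Suc k)
    then obtain c where c: "mat2 (\<alpha> k * p + c) (\<alpha> k * q) (\<alpha> k * r) (\<alpha> k * s + c) \<in> H" ..
    have *: "x * q * (y * r) = x * y * (1 + p * (p + t ^ 2))" "x * r * (y * q) = x * y * (1 + p * (p + t ^ 2))" for x y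
      unfolding qr[symmetric] by (simp_all add: mult_ac)
    \<comment> \<open>Squaring \<open>\<alpha> k\<close> d + c and replacing d^2 by t^2 d + 1 leaves
      the witness below as constant term.\<close>
    show ?case
      using H(1)[OF c c]
      by (intro exI[of _ "c ^ 2 + (\<alpha> k) ^ 2"])
        (simp add: \<alpha> s *, simp add: algebra_simps power2_eq_square)
  qed
  then obtain c where c: "mat2 (\<alpha> (e-1) * p + c) (\<alpha> (e-1) * q) (\<alpha> (e-1) * r) (\<alpha> (e-1) * s + c) \<in> H"
    by blast
  have "(t ^ 2) ^ 2 ^ (e - 1) = t"
    using t(3,4) by (simp add: GF_2_pow_def flip: power_mult power_Suc)
  then have \<alpha>e: "\<alpha> (e-1) = 1 / t"
    using t(2) by (simp add: \<alpha>_def power2_eq_square)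
  define c' where "c' = c * t"
  have c': "c = c' / t"
    using t(2) by (simp add: c'_def)
  have c2: "mat2 ((p + c') / t) (q / t) (r / t) ((s + c') / t) \<in> H"
    using c unfolding \<alpha>e c' by (simp add: add_divide_distrib)
  have "((p + c') * (s + c') + q * r) / t ^ 2 = 1"
    using H(2)[OF c2] by (simp add: det_mat2 power2_eq_square flip: add_divide_distrib)
  then have "(p + c') * (s + c') + q * r = t ^ 2"
    using t(2) by simp
  \<comment> \<open>The determinant condition is thus a quadratic equation for \<open>c'\<close>
    with roots 1 and 1 + t^2.\<close>
  moreover have "(p + c') * (s + c') + q * r + t ^ 2 = (c' + 1) * (c' + 1 + t ^ 2)"
    unfolding qr s by (simp add: algebra_simps power2_eq_square)
  ultimately have "(c' + 1) * (c' + 1 + t ^ 2) = 0"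
    by simp
  then consider "c' = 1" | "c' = 1 + t ^ 2"
    by (auto simp: gf2bar_add_eq_0 add.assoc)
  then show ?thesis
  proof cases
    case 1
    then show ?thesis using c2 by simp
  next
    case 2
    \<comment> \<open>Since d + d^(-1) = t^2, the power reached here is the inverse of the root; one
      more factor d gives the root itself.\<close>
    have "(p + c') / t * p + q / t * r = (p + 1) / t" "(p + c') / t * q + q / t * s = q / t"
      "r / t * p + (s + c') / t * r = r / t" "r / t * q + (s + c') / t * s = (s + 1) / t"
      using t(2) qr unfolding 2 s
      by (auto simp: field_simps power2_eq_square)
    then show ?thesis
      using H(1)[OF c2 d] by simp
  qed
qed


section \<open>Generating \<open>SL\<^sub>2\<close>\<close>

text \<open>The last hypothesis says that \<open>a\<close> lies in no proper subring of the field.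
  The set \<open>S\<close> below is closed under addition and under z * x / y and contains 1, so it
  is a subring containing \<open>a\<close>, hence the whole field; unipotent matrices and
  \<open>swap_mat\<close> then give everything.\<close>

lemma SL2_GF_generation:
  fixes H :: "(gf2bar ^ 2 ^ 2) set"
  assumes e: "e > 0"
    and H: "\<And>A B. A \<in> H \<Longrightarrow> B \<in> H \<Longrightarrow> A ** B \<in> H" "H \<subseteq> carrier (SL2 (GF_2_pow e))"
    and gens: "upper a \<in> H" "upper b \<in> H" "swap_mat \<in> H"
    and ab: "a \<noteq> 0" "b \<noteq> 0" "a \<noteq> b"
    and a: "\<And>F. F \<subseteq> GF_2_pow e \<Longrightarrow> a \<in> F \<Longrightarrow> 0 \<in> F \<Longrightarrow> 1 \<in> F \<Longrightarrow>
      (\<And>x y. x \<in> F \<Longrightarrow> y \<in> F \<Longrightarrow> x + y \<in> F \<and> x * y \<in> F) \<Longrightarrow> F = GF_2_pow e"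
  shows "H = carrier (SL2 (GF_2_pow e))"
proof
  have det: "det A = 1" if "A \<in> H" for A
    using that H(2) by (auto simp: SL2_def)
  define S where "S = {x. upper x \<in> H}"
  have S_upper: "upper x \<in> H" if "x \<in> S" for x
    using that by (simp add: S_def)
  have S_GF: "x \<in> GF_2_pow e" if "x \<in> S" for x
    using S_upper[OF that] H(2) by (auto simp: mat2_in_SL2)
  have S_lower: "lower x \<in> H \<longleftrightarrow> x \<in> S" for x
  proof
    assume "lower x \<in> H"
    from H(1)[OF H(1)[OF gens(3) this] gens(3)] show "x \<in> S" by (simp add: S_def)
  next
    assume "x \<in> S"
    from H(1)[OF H(1)[OF gens(3) S_upper[OF this]] gens(3)] show "lower x \<in> H" by simp
  qed
  have S_add: "x + y \<in> S" if "x \<in> S" "y \<in> S" for x y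
    using H(1)[OF S_upper[OF that(1)] S_upper[OF that(2)]] by (simp add: S_def add.commute)
  have S0: "0 \<in> S"
    using S_add[of a a] gens(1) by (simp add: S_def)
  \<comment> \<open>The square root of \<open>upper (x\<^sup>2) ** swap_mat\<close>; it conjugates \<open>upper (x\<^sup>2)\<close> into \<open>swap_mat\<close>.\<close>
  have g: "mat2 ((x ^ 2 + 1) / x) (1 / x) (1 / x) (1 / x) \<in> H" if "x ^ 2 \<in> S" "x \<noteq> 0" "x \<in> GF_2_pow e" for x
  proof -
    have "mat2 (x ^ 2) 1 1 0 \<in> H"
      using H(1)[OF S_upper[OF that(1)] gens(3)] by simp
    from SL2_sqrt_mem[OF H(1) det this _ that(2,3) e] show ?thesis by simp
  qed
  \<comment> \<open>Conjugation by \<open>swap_mat\<close> inverts the preceding square roots, so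
    this is a quotient of two of them. It conjugates \<open>lower (x ^ 2)\<close> into
    \<open>lower (y ^ 2)\<close>, which is why it is lower triangular.\<close>
  have m: "mat2 (y / x) 0 ((x ^ 2 + y ^ 2) / (x * y)) (x / y) \<in> H"
    if "x ^ 2 \<in> S" "x \<noteq> 0" "x \<in> GF_2_pow e" "y ^ 2 \<in> S" "y \<noteq> 0" "y \<in> GF_2_pow e" for x y
  proof -
    have "swap_mat ** mat2 ((x ^ 2 + 1) / x) (1 / x) (1 / x) (1 / x) ** swap_mat **
        mat2 ((y ^ 2 + 1) / y) (1 / y) (1 / y) (1 / y) \<in> H"
      by (intro H(1) gens(3) g that)
    also have "swap_mat ** mat2 ((x ^ 2 + 1) / x) (1 / x) (1 / x) (1 / x) ** swap_mat **
        mat2 ((y ^ 2 + 1) / y) (1 / y) (1 / y) (1 / y) =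
        mat2 (y / x) 0 ((x ^ 2 + y ^ 2) / (x * y)) (x / y)"
      using that by (simp add: divide_simps, (simp add: algebra_simps power2_eq_square)?)
    finally show ?thesis .
  qed
  \<comment> \<open>The product of \<open>upper (x ^ 2)\<close> and \<open>lower (y ^ 2)\<close> has
    trace (x y)^2. Its square root has lower right entry 0, so \<open>swap_mat\<close> makes it
    triangular and \<open>upper (y ^ 2)\<close> clears the remaining entry.\<close>
  have diag: "mat2 (x / y) 0 0 (y / x) \<in> H"
    if "x ^ 2 \<in> S" "x \<noteq> 0" "x \<in> GF_2_pow e" "y ^ 2 \<in> S" "y \<noteq> 0" "y \<in> GF_2_pow e" for x y
  proof -
    have "mat2 (1 + x ^ 2 * y ^ 2) (x ^ 2) (y ^ 2) 1 \<in> H"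
      using H(1)[OF S_upper[OF that(1)] S_lower[THEN iffD2, OF that(4)]] by simp
    moreover have "1 + x ^ 2 * y ^ 2 + 1 = (x * y) ^ 2"
      by (simp add: power_mult_distrib algebra_simps)
    ultimately have "mat2 ((1 + x ^ 2 * y ^ 2 + 1) / (x * y)) (x ^ 2 / (x * y)) (y ^ 2 / (x * y)) ((1 + 1) / (x * y)) \<in> H"
      using that by (intro SL2_sqrt_mem[OF H(1) det _ _ _ _ e] GF_2_pow_subfield) auto
    then have "mat2 ((1 + x ^ 2 * y ^ 2 + 1) / (x * y)) (x ^ 2 / (x * y)) (y ^ 2 / (x * y)) ((1 + 1) / (x * y)) **
        swap_mat ** upper (y ^ 2) \<in> H"
      by (intro H(1) gens(3) S_upper that)
    also have "mat2 ((1 + x ^ 2 * y ^ 2 + 1) / (x * y)) (x ^ 2 / (x * y)) (y ^ 2 / (x * y)) ((1 + 1) / (x * y)) **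
        swap_mat ** upper (y ^ 2) = mat2 (x / y) 0 0 (y / x)"
      using that by (simp add: divide_simps, (simp add: algebra_simps power2_eq_square)?)
    finally show ?thesis .
  qed
  \<comment> \<open>Conjugation by the diagonal matrix built from the square roots of x and y scales
    the entry z by x / y.\<close>
  have S_frac: "z * x / y \<in> S" if z: "z \<in> S" and x: "x \<in> S" and y: "y \<in> S" for x y z
  proof (cases "x = 0 \<or> y = 0")
    case False
    obtain r where r: "r \<in> GF_2_pow e" "x = r ^ 2"
      using GF_2_pow_sqrt[OF e S_GF[OF x]] by blast
    obtain s where s: "s \<in> GF_2_pow e" "y = s ^ 2"
      using GF_2_pow_sqrt[OF e S_GF[OF y]] by blast
    have rs: "r \<noteq> 0" "s \<noteq> 0"
      using False r s by auto
    have "mat2 (r / s) 0 0 (s / r) ** upper z ** mat2 (s / r) 0 0 (r / s) \<in> H"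
      using r s x y rs by (intro H(1) diag S_upper z) auto
    also have "mat2 (r / s) 0 0 (s / r) ** upper z ** mat2 (s / r) 0 0 (r / s) = upper (z * x / y)"
      using rs by (simp add: r s divide_simps, (simp add: algebra_simps power2_eq_square)?)
    finally show ?thesis by (simp add: S_def)
  \<comment> \<open>Division by zero yields 0, so both degenerate cases reduce to 0 being in
    \<open>S\<close>.\<close>
  qed (use S0 in auto)
  \<comment> \<open>Cancelling the diagonal part of the triangular matrix from \<open>m\<close>
    leaves a lower unipotent matrix with this entry.\<close>
  have S_ratio: "1 + y / x \<in> S" if x: "x \<in> S" and y: "y \<in> S" and xy: "x \<noteq> 0" "y \<noteq> 0" for x y
  proof -
    obtain r where r: "r \<in> GF_2_pow e" "x = r ^ 2"
      using GF_2_pow_sqrt[OF e S_GF[OF x]] by blast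
    obtain s where s: "s \<in> GF_2_pow e" "y = s ^ 2"
      using GF_2_pow_sqrt[OF e S_GF[OF y]] by blast
    have rs: "r \<noteq> 0" "s \<noteq> 0"
      using xy r s by auto
    have "mat2 (r / s) 0 0 (s / r) ** mat2 (s / r) 0 ((r ^ 2 + s ^ 2) / (r * s)) (r / s) \<in> H"
      using r s x y rs by (intro H(1) diag m) auto
    also have "mat2 (r / s) 0 0 (s / r) ** mat2 (s / r) 0 ((r ^ 2 + s ^ 2) / (r * s)) (r / s) =
        lower (1 + y / x)"
      using rs by (simp add: r s divide_simps, (simp add: algebra_simps power2_eq_square)?)
    finally show ?thesis by (simp add: S_lower)
  qed
  have ab': "a \<in> S" "b \<in> S"
    using gens by (simp_all add: S_def)
  \<comment> \<open>Two ratios chosen so that their sum collapses to 1; the second needs a + b to be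
    nonzero, that is \<open>a \<noteq> b\<close>.\<close>
  have "(1 + b / a) + (1 + (a + b) / a) \<in> S"
    using ab by (intro S_add S_ratio ab') (auto simp: gf2bar_add_eq_0)
  also have "(1 + b / a) + (1 + (a + b) / a) = 1"
    using ab by (simp add: divide_simps, (simp add: algebra_simps)?)
  finally have S1: "1 \<in> S" .
  have S: "S = GF_2_pow e"
    using S_frac[OF _ _ S1] S_GF ab' S0 S1 S_add by (intro a) auto
  show "carrier (SL2 (GF_2_pow e)) \<subseteq> H"
  proof
    fix A assume A: "A \<in> carrier (SL2 (GF_2_pow e))"
    have *: "mat2 p q r s \<in> H" if "mat2 p q r s \<in> carrier (SL2 (GF_2_pow e))" "r \<noteq> 0" for p q r s
    proof -
      have in_GF: "p \<in> GF_2_pow e" "q \<in> GF_2_pow e" "r \<in> GF_2_pow e" "s \<in> GF_2_pow e" and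
        det: "p * s + q * r = 1"
        using that(1) by (auto simp: mat2_in_SL2)
      have q: "q * r = 1 + p * s"
        using det by (metis add.commute gf2bar_add_self(2))
      have "upper ((p + 1) / r) ** lower r ** upper ((s + 1) / r) \<in> H"
        by (intro H(1) S_upper S_lower[THEN iffD2]; unfold S)
          (auto intro!: GF_2_pow_divide GF_2_pow_subfield in_GF)
      also have "upper ((p + 1) / r) ** lower r ** upper ((s + 1) / r) = mat2 p q r s"
        using that(2) q by (simp add: divide_simps, (simp add: algebra_simps)?)
      finally show ?thesis .
    qed
    obtain p q r s where pqrs: "A = mat2 p q r s" by (rule mat2_cases)
    show "A \<in> H"
    proof (cases "r = 0")
      case False
      with * A pqrs show ?thesis by simp
    next
      case True
      \<comment> \<open>Exchanging the rows puts p in the lower left corner, and p is nonzero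
        because p * s = 1.\<close>
      then have "mat2 r s p q \<in> H"
        using A unfolding pqrs by (intro *) (auto simp: mat2_in_SL2 algebra_simps)
      from H(1)[OF gens(3) this] show ?thesis by (simp add: pqrs)
    qed
  qed
qed (rule H(2))


section \<open>Elements of trace zero generating the field\<close>

lemma frobenius_period:
  fixes a :: gf2bar
  assumes "a ^ 2 ^ m = a"
  shows "a ^ 2 ^ (m * k) = a"
proof (induction k)
  case (Suc k)
  have "a ^ 2 ^ (m * Suc k) = (a ^ 2 ^ m) ^ 2 ^ (m * k)"
    by (simp add: power_add power_mult)
  with Suc assms show ?case by simp
qed simp

text \<open>The least period of \<open>a\<close> under squaring divides e, and a proper divisor of e
  is at most \<open>e div 2\<close>. Having to exclude only these short periods is what makes the
  later count succeed.\<close>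

lemma frobenius_min_period:
  fixes a :: gf2bar
  assumes "a \<in> GF_2_pow e" and small: "\<And>j. 0 < j \<Longrightarrow> j \<le> e div 2 \<Longrightarrow> a ^ 2 ^ j \<noteq> a"
    and "0 < j" "j < e"
  shows "a ^ 2 ^ j \<noteq> a"
proof
  assume "a ^ 2 ^ j = a"
  define m where "m = (LEAST m. 0 < m \<and> a ^ 2 ^ m = a)"
  have m: "0 < m" "a ^ 2 ^ m = a"
    using LeastI[of "\<lambda>m. 0 < m \<and> a ^ 2 ^ m = a" j] \<open>0 < j\<close> \<open>a ^ 2 ^ j = a\<close>
    by (auto simp: m_def)
  have "m \<le> j"
    using \<open>0 < j\<close> \<open>a ^ 2 ^ j = a\<close> by (auto simp: m_def intro: Least_le)
  have "a = a ^ 2 ^ (m * (e div m) + e mod m)"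
    using assms(1) by (simp add: GF_2_pow_def)
  also have "\<dots> = a ^ 2 ^ (e mod m)"
    unfolding power_add power_mult using frobenius_period[OF m(2)] by (simp add: power_mult)
  finally have "a ^ 2 ^ (e mod m) = a" by simp
  then have "e mod m = 0"
    using not_less_Least[of "e mod m" "\<lambda>m. 0 < m \<and> a ^ 2 ^ m = a"] \<open>0 < m\<close>
    by (auto simp flip: m_def)
  then obtain k where k: "e = m * k" by (auto elim: dvdE)
  with \<open>m \<le> j\<close> \<open>j < e\<close> have "k \<ge> 2" by (cases k; cases "k - 1") auto
  then have "2 * m \<le> e"
    by (simp add: k)
  then have "m \<le> e div 2" by simp
  with small m show False by blast
qed

text \<open>\<open>Y\<close> collects the bad choices of y, those for which y + y^(2^m) has period
  j. In characteristic two they are the roots of a nonzero polynomial of degree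
  \<open>2 ^ (m + j)\<close>.\<close>

lemma card_artin_schreier_le:
  assumes "m > 0" "j > 0"
  defines "Y \<equiv> {y :: gf2bar. (y + y ^ 2 ^ m) ^ 2 ^ j = y + y ^ 2 ^ m}"
  shows "finite Y \<and> card Y \<le> 2 ^ (m + j)"
proof -
  define p :: "gf2bar poly" where
    "p = Polynomial.monom 1 (2 ^ j) + Polynomial.monom 1 (2 ^ (m + j)) +
       (Polynomial.monom 1 1 + Polynomial.monom 1 (2 ^ m))"
  \<comment> \<open>Positivity of m and j keeps the top exponent apart from the other three.\<close>
  have "poly.coeff p (2 ^ (m + j)) = 1"
    using assms(1,2) one_less_power[of "2 :: nat" "m + j"] by (auto simp: p_def)
  then have p: "p \<noteq> 0" by auto
  have deg: "Polynomial.degree p \<le> 2 ^ (m + j)"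
    unfolding p_def
    by (intro Polynomial.degree_add_le order.trans[OF Polynomial.degree_monom_le]) auto
  have "poly p y = (y + y ^ 2 ^ m) ^ 2 ^ j + (y + y ^ 2 ^ m)" for y
    by (simp add: p_def poly_monom gf2bar_add_pow power_add power_mult)
  then have Y: "Y = {y. poly p y = 0}"
    by (simp add: Y_def gf2bar_add_eq_0)
  have "card Y \<le> Polynomial.degree p"
    unfolding Y by (rule card_poly_roots_bound[OF p])
  with deg poly_roots_finite[OF p] show ?thesis
    unfolding Y by auto
qed

text \<open>With \<open>h = 3 * m div 2\<close>, the bad y number less than 2^(m+h+1), which is at
  most 2^(3m), so a good y remains. The additive relation holds for every y + y^(2^m), because
  applying x -> x^(2^m) three times is the identity on the field.\<close>

lemma ex_trace_zero_generator:
  assumes "m > 0"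
  obtains a where "a \<in> GF_2_pow (3 * m)" "a + a ^ 2 ^ m = (a ^ 2 ^ m) ^ 2 ^ m"
    "\<And>j. 0 < j \<Longrightarrow> j < 3 * m \<Longrightarrow> a ^ 2 ^ j \<noteq> a"
proof -
  define Y where "Y j = {y :: gf2bar. (y + y ^ 2 ^ m) ^ 2 ^ j = y + y ^ 2 ^ m}" for j :: nat
  define h where "h = 3 * m div 2"
  have Y: "finite (Y j)" "card (Y j) \<le> 2 ^ (m + j)" if "j > 0" for j
    using card_artin_schreier_le[OF assms that] by (auto simp: Y_def)
  have "card (\<Union>j\<in>{1..h}. Y j) \<le> (\<Sum>j\<in>{1..h}. card (Y j))"
    by (rule card_UN_le) simp
  also have "\<dots> \<le> (\<Sum>j\<in>{1..h}. 2 ^ (m + j))"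
    by (intro sum_mono Y) auto
  also have "\<dots> < 2 ^ (m + h + 1)"
    by (induction h) auto
  also have "\<dots> \<le> 2 ^ (3 * m)"
    using assms by (intro power_increasing) (auto simp: h_def)
  also have "\<dots> = card (GF_2_pow (3 * m))"
    using assms by (simp add: card_GF_2_pow)
  finally have "\<not> GF_2_pow (3 * m) \<subseteq> (\<Union>j\<in>{1..h}. Y j)"
    using card_mono[of "\<Union>j\<in>{1..h}. Y j" "GF_2_pow (3 * m)"] Y by (auto simp: not_less)
  then obtain y where y: "y \<in> GF_2_pow (3 * m)" "\<And>j. j \<in> {1..h} \<Longrightarrow> y \<notin> Y j"
    by blast
  define a where "a = y + y ^ 2 ^ m"
  have a_GF: "a \<in> GF_2_pow (3 * m)"
    unfolding a_def by (intro GF_2_pow_subfield GF_2_pow_power y)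
  have "((y ^ 2 ^ m) ^ 2 ^ m) ^ 2 ^ m = y ^ 2 ^ (m + m + m)"
    by (simp flip: power_mult power_add)
  also have "m + m + m = 3 * m" by simp
  also have "y ^ 2 ^ (3 * m) = y"
    using y(1) by (simp add: GF_2_pow_def)
  finally have "a + a ^ 2 ^ m = (a ^ 2 ^ m) ^ 2 ^ m"
    by (simp add: a_def gf2bar_add_pow add_ac)
  moreover have "a ^ 2 ^ j \<noteq> a" if "0 < j" "j \<le> 3 * m div 2" for j
    using y(2)[of j] that by (auto simp: Y_def a_def h_def)
  ultimately show ?thesis
    using that a_GF frobenius_min_period[OF a_GF] by blast
qed

text \<open>The sums of powers a^i over the 2^e subsets of \<open>{..<e}\<close> are distinct: a
  coincidence would give a nonzero polynomial of degree below e with coefficients 0 and 1 that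
  vanishes at all e conjugates of a. These sums lie in \<open>F\<close> and exhaust the
  field.\<close>

lemma generator_GF_2_pow:
  assumes e: "e > 0" and a: "a \<in> GF_2_pow e" "\<And>j. 0 < j \<Longrightarrow> j < e \<Longrightarrow> a ^ 2 ^ j \<noteq> a"
    and F: "F \<subseteq> GF_2_pow e" "a \<in> F" "0 \<in> F" "1 \<in> F"
      "\<And>x y. x \<in> F \<Longrightarrow> y \<in> F \<Longrightarrow> x + y \<in> F \<and> x * y \<in> F"
  shows "F = GF_2_pow e"
proof -
  define f where "f S = (\<Sum>i\<in>S. a ^ i)" for S :: "nat set"
  have inj_conj: "inj_on (\<lambda>j. a ^ 2 ^ j) {..<e}"
  proof (rule linorder_inj_onI)
    fix i j assume "i < j" "i \<in> {..<e}" "j \<in> {..<e}"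
    show "a ^ 2 ^ i \<noteq> a ^ 2 ^ j"
    proof
      assume "a ^ 2 ^ i = a ^ 2 ^ j"
      \<comment> \<open>This power sends the larger conjugate back to a and exposes the forbidden
        period i + (e - j) < e.\<close>
      then have "(a ^ 2 ^ i) ^ 2 ^ (e - j) = (a ^ 2 ^ j) ^ 2 ^ (e - j)" by simp
      then have "a ^ 2 ^ (i + (e - j)) = a ^ 2 ^ e"
        using \<open>j \<in> {..<e}\<close> by (simp flip: power_mult power_add)
      with a(1) have "a ^ 2 ^ (i + (e - j)) = a" by (simp add: GF_2_pow_def)
      moreover have "0 < i + (e - j)" "i + (e - j) < e"
        using \<open>i < j\<close> \<open>j \<in> {..<e}\<close> unfolding lessThan_iff by linarith+
      ultimately show False using a(2)[of "i + (e - j)"] by simp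
    qed
  qed auto
  have "inj_on f (Pow {..<e})"
  proof (rule inj_onI, rule ccontr)
    fix S T assume S: "S \<in> Pow {..<e}" and T: "T \<in> Pow {..<e}" and eq: "f S = f T" and ne: "S \<noteq> T"
    have fin: "finite S" "finite T" using S T finite_subset[of _ "{..<e}"] by auto
    define p :: "gf2bar poly" where
      "p = (\<Sum>i\<in>S. Polynomial.monom 1 i) + (\<Sum>i\<in>T. Polynomial.monom 1 i)"
    have coeff: "poly.coeff p i = of_bool (i \<in> S) + of_bool (i \<in> T)" for i
      using fin by (simp add: p_def coeff_sum coeff_monom of_bool_def)
    obtain i where "i \<in> S \<longleftrightarrow> i \<notin> T" using ne by blast
    then have "poly.coeff p i \<noteq> 0" by (auto simp: coeff)
    then have p: "p \<noteq> 0" by auto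
    have "poly.coeff p i = 0" if "i \<ge> e" for i
      using that S T by (auto simp: coeff)
    then have "Polynomial.degree p \<le> e - 1"
      by (intro Polynomial.degree_le) auto
    moreover have "(\<lambda>j. a ^ 2 ^ j) ` {..<e} \<subseteq> {x. poly p x = 0}"
    proof clarify
      fix j
      \<comment> \<open>Coefficients 0 and 1 are fixed by squaring, so the value at a conjugate is
        the conjugate of the value at a.\<close>
      have "poly p (a ^ 2 ^ j) = (f S + f T) ^ 2 ^ j"
        by (simp add: p_def poly_sum poly_monom f_def gf2bar_add_pow gf2bar_sum_pow
            mult.commute flip: power_mult)
      also have "\<dots> = 0" by (simp add: eq)
      finally show "poly p (a ^ 2 ^ j) = 0" .
    qed
    then have "card ((\<lambda>j. a ^ 2 ^ j) ` {..<e}) \<le> card {x. poly p x = 0}"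
      by (intro card_mono poly_roots_finite p)
    ultimately show False
      using card_poly_roots_bound[OF p] e by (simp add: card_image[OF inj_conj])
  qed
  then have "card (f ` Pow {..<e}) = card (GF_2_pow e)"
    by (simp add: card_image card_Pow card_GF_2_pow[OF e])
  moreover have pow: "a ^ i \<in> F" for i
    by (induction i) (use F in auto)
  have "f S \<in> F" for S
    unfolding f_def by (induction S rule: infinite_finite_induct) (use F pow in auto)
  then have "f ` Pow {..<e} \<subseteq> F" by blast
  ultimately show ?thesis
    using F(1) card_subset_eq[OF finite_GF_2_pow[OF e], of "f ` Pow {..<e}"] by blast
qed


section \<open>Homomorphisms from presented groups\<close>

definition word_eval :: "('a, 'b) monoid_scheme \<Rightarrow> ('g \<Rightarrow> 'a) \<Rightarrow> 'g word \<Rightarrow> 'a" where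
  "word_eval G f w =
     foldr (\<lambda>(g, b) x. (if b then f g else inv\<^bsub>G\<^esub> f g) \<otimes>\<^bsub>G\<^esub> x) w \<one>\<^bsub>G\<^esub>"

context Group.group
begin

lemma word_eval_simps [simp]:
  "word_eval G f [] = \<one>"
  "word_eval G f ((g, b) # w) = (if b then f g else inv f g) \<otimes> word_eval G f w"
  by (simp_all add: word_eval_def)

lemma word_eval_closed:
  assumes "\<And>g. f g \<in> carrier G"
  shows "word_eval G f w \<in> carrier G"
  by (induction w) (use assms in auto)

lemma word_eval_append:
  assumes "\<And>g. f g \<in> carrier G"
  shows "word_eval G f (v @ w) = word_eval G f v \<otimes> word_eval G f w"
  by (induction v) (use assms word_eval_closed[of f] in \<open>auto simp: m_assoc\<close>)

lemma word_eval_pres_eq: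
  assumes f: "\<And>g. f g \<in> carrier G" and rels: "\<And>r. r \<in> Rels \<Longrightarrow> word_eval G f r = \<one>"
  shows "pres_eq Rels v w \<Longrightarrow> word_eval G f v = word_eval G f w"
  by (induction rule: pres_eq.induct) (use f rels in \<open>auto simp: word_eval_append\<close>)

text \<open>Von Dyck's theorem. \<open>h\<close> evaluates an arbitrary representative, and
  evaluation is constant on classes.\<close>

lemma presented_group_hom_exists:
  assumes f: "\<And>g. f g \<in> carrier G" and rels: "\<And>r. r \<in> Rels \<Longrightarrow> word_eval G f r = \<one>"
  shows "\<exists>h\<in>hom (presented_group Rels) G. \<forall>g. h (pres_rel Rels `` {[(g, True)]}) = f g"
proof
  define h where "h A = word_eval G f (SOME w. w \<in> A)" for A
  have h: "h (pres_rel Rels `` {w}) = word_eval G f w" for w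
  proof -
    have "w \<in> pres_rel Rels `` {w}"
      by (simp add: pres_rel_def pres_eq.refl)
    then have "(SOME v. v \<in> pres_rel Rels `` {w}) \<in> pres_rel Rels `` {w}"
      by (rule someI)
    then have "pres_eq Rels w (SOME v. v \<in> pres_rel Rels `` {w})"
      by (simp add: pres_rel_def)
    then show ?thesis
      unfolding h_def using word_eval_pres_eq[OF f rels] by metis
  qed
  show "h \<in> hom (presented_group Rels) G"
  proof (rule homI)
    fix A B assume "A \<in> carrier (presented_group Rels)" "B \<in> carrier (presented_group Rels)"
    then obtain v w where "A = pres_rel Rels `` {v}" "B = pres_rel Rels `` {w}"
      by (auto simp: presented_group_def quotient_def)
    then show "h A \<in> carrier G" "h (A \<otimes>\<^bsub>presented_group Rels\<^esub> B) = h A \<otimes> h B"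
      by (simp_all add: h presented_group_mult word_eval_closed f word_eval_append)
  qed
  show "\<forall>g. h (pres_rel Rels `` {[(g, True)]}) = f g"
    using f by (simp add: h)
qed

text \<open>The uniqueness counterpart: the class of an inverse letter is the inverse class, so the
  images of the generators determine the homomorphism.\<close>

lemma presented_group_hom_word_eval:
  assumes h: "h \<in> hom (presented_group Rels) G"
  shows "h (pres_rel Rels `` {w}) = word_eval G (\<lambda>g. h (pres_rel Rels `` {[(g, True)]})) w"
proof -
  let ?P = "presented_group Rels" and ?c = "\<lambda>w. pres_rel Rels `` {w}"
  interpret h: group_hom ?P G h
    using h by (simp add: group_hom_def group_hom_axioms_def group_presented_group is_group)
  have c: "?c v \<in> carrier ?P" for v
    by (auto simp: presented_group_def quotient_def)
  have inv_letter: "?c [(g, False)] = inv\<^bsub>?P\<^esub> ?c [(g, True)]" for g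
  proof (rule h.G.inv_equality[symmetric])
    have "pres_eq Rels [(g, False), (g, True)] []"
      using pres_eq.cancel[of Rels g False] by simp
    then have "?c [(g, False), (g, True)] = ?c []"
      by (intro equiv_class_eq[OF equiv_pres_rel]) (simp add: pres_rel_def)
    then show "?c [(g, False)] \<otimes>\<^bsub>?P\<^esub> ?c [(g, True)] = \<one>\<^bsub>?P\<^esub>"
      by (simp add: presented_group_mult) (simp add: presented_group_def)
  qed (rule c)+
  show ?thesis
  proof (induction w)
    case Nil
    show ?case
      using h.hom_one by (simp add: presented_group_def)
  next
    case (Cons x w)
    obtain g b where x: "x = (g, b)" by fastforce
    have "?c (x # w) = ?c [x] \<otimes>\<^bsub>?P\<^esub> ?c w"
      by (simp add: presented_group_mult)
    moreover have "h (?c [x]) = (if b then h (?c [(g, True)]) else inv h (?c [(g, True)]))"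
      using c by (cases b) (simp_all add: x inv_letter)
    ultimately show ?case
      using Cons c by (simp add: x)
  qed
qed

lemma presented_group_hom_eqI:
  assumes "h \<in> hom (presented_group Rels) G" "h' \<in> hom (presented_group Rels) G"
    and "\<And>g. h (pres_rel Rels `` {[(g, True)]}) = h' (pres_rel Rels `` {[(g, True)]})"
    and "A \<in> carrier (presented_group Rels)"
  shows "h A = h' A"
proof -
  obtain w where "A = pres_rel Rels `` {w}"
    using assms(4) by (auto simp: presented_group_def quotient_def)
  then show ?thesis
    using presented_group_hom_word_eval[OF assms(1), of w]
      presented_group_hom_word_eval[OF assms(2), of w] assms(3) by simp
qed

end

section \<open>Relations in \<open>Gamma\<close> and homomorphisms out of it\<close>

lemma group_Gamma: "Group.group Gamma"
  unfolding Gamma_def by (rule group_presented_group)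

lemma gamma_class_closed [simp]: "gamma_class g \<in> carrier Gamma"
  by (auto simp: gamma_class_def Gamma_def presented_group_def quotient_def)

lemma Gamma_relations:
  "R0 \<otimes>\<^bsub>Gamma\<^esub> R0 = \<one>\<^bsub>Gamma\<^esub>" "R1 \<otimes>\<^bsub>Gamma\<^esub> R1 = \<one>\<^bsub>Gamma\<^esub>"
  "R2 \<otimes>\<^bsub>Gamma\<^esub> R2 = \<one>\<^bsub>Gamma\<^esub>" "R02 \<otimes>\<^bsub>Gamma\<^esub> R02 = \<one>\<^bsub>Gamma\<^esub>"
proof -
  have *: "pres_rel gamma_relators `` {r} = \<one>\<^bsub>Gamma\<^esub>" if "r \<in> gamma_relators" for r
  proof -
    have "pres_rel gamma_relators `` {r} = pres_rel gamma_relators `` {[]}"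
      using that by (intro equiv_class_eq[OF equiv_pres_rel]) (simp add: pres_rel_def pres_eq.relator)
    then show ?thesis by (simp add: Gamma_def presented_group_def)
  qed
  have mem: "[(G0, True), (G0, True)] \<in> gamma_relators" "[(G1, True), (G1, True)] \<in> gamma_relators"
    "[(G2, True), (G2, True)] \<in> gamma_relators"
    "[(G0, True), (G2, True), (G0, True), (G2, True)] \<in> gamma_relators"
    by (simp_all add: gamma_relators_def)
  show "R0 \<otimes>\<^bsub>Gamma\<^esub> R0 = \<one>\<^bsub>Gamma\<^esub>" "R1 \<otimes>\<^bsub>Gamma\<^esub> R1 = \<one>\<^bsub>Gamma\<^esub>"
    "R2 \<otimes>\<^bsub>Gamma\<^esub> R2 = \<one>\<^bsub>Gamma\<^esub>" "R02 \<otimes>\<^bsub>Gamma\<^esub> R02 = \<one>\<^bsub>Gamma\<^esub>"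
    using mem[THEN *]
    by (simp_all add: gamma_class_def presented_group_mult[of gamma_relators, folded Gamma_def])
qed

text \<open>\<open>R02\<close> is its own inverse, and inversion reverses its two factors.\<close>

lemma Gamma_commute: "R2 \<otimes>\<^bsub>Gamma\<^esub> R0 = R02"
proof -
  interpret Group.group Gamma by (rule group_Gamma)
  have "inv\<^bsub>Gamma\<^esub> R02 = R02"
    by (rule inv_equality) (simp_all add: Gamma_relations)
  moreover have "inv\<^bsub>Gamma\<^esub> R0 = R0" "inv\<^bsub>Gamma\<^esub> R2 = R2"
    by (rule inv_equality; simp add: Gamma_relations)+
  ultimately show ?thesis
    by (simp add: inv_mult_group)
qed

lemma Gamma_hom_exists:
  assumes "Group.group G" "x \<in> carrier G" "y \<in> carrier G" "z \<in> carrier G"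
    and "x \<otimes>\<^bsub>G\<^esub> x = \<one>\<^bsub>G\<^esub>" "y \<otimes>\<^bsub>G\<^esub> y = \<one>\<^bsub>G\<^esub>" "z \<otimes>\<^bsub>G\<^esub> z = \<one>\<^bsub>G\<^esub>"
    and "(x \<otimes>\<^bsub>G\<^esub> z) \<otimes>\<^bsub>G\<^esub> (x \<otimes>\<^bsub>G\<^esub> z) = \<one>\<^bsub>G\<^esub>"
  obtains h where "h \<in> hom Gamma G" "h R0 = x" "h R1 = y" "h R2 = z"
proof -
  interpret Group.group G by fact
  define f where "f = case_gamma_gen x y z"
  have "f g \<in> carrier G" for g
    using assms by (cases g) (auto simp: f_def)
  moreover have "word_eval G f r = \<one>\<^bsub>G\<^esub>" if "r \<in> gamma_relators" for r
    using that assms by (auto simp: gamma_relators_def f_def m_assoc)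
  ultimately have "\<exists>h\<in>hom Gamma G. \<forall>g. h (gamma_class g) = f g"
    unfolding Gamma_def gamma_class_def by (rule presented_group_hom_exists)
  then show ?thesis
    using that by (auto simp: f_def)
qed

lemma Gamma_hom_eqI:
  assumes "Group.group G" "h \<in> hom Gamma G" "h' \<in> hom Gamma G"
    and "h R0 = h' R0" "h R1 = h' R1" "h R2 = h' R2" and "A \<in> carrier Gamma"
  shows "h A = h' A"
proof (rule group.presented_group_hom_eqI[OF assms(1) assms(2,3)[unfolded Gamma_def] _ assms(7)[unfolded Gamma_def]])
  show "h (pres_rel gamma_relators `` {[(g, True)]}) = h' (pres_rel gamma_relators `` {[(g, True)]})" for g
    using assms(4-6) by (cases g) (auto simp: gamma_class_def)
qed


section \<open>Trialities and dualities\<close>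

definition frobenius_mat :: "nat \<Rightarrow> gf2bar ^ 2 ^ 2 \<Rightarrow> gf2bar ^ 2 ^ 2" where
  "frobenius_mat k A = (\<chi> i j. vec_nth (vec_nth A i) j ^ 2 ^ k)"

lemma frobenius_mat2 [simp]:
  "frobenius_mat k (mat2 p q r s) = mat2 (p ^ 2 ^ k) (q ^ 2 ^ k) (r ^ 2 ^ k) (s ^ 2 ^ k)"
  by (simp add: frobenius_mat_def mat2_def vec_eq_iff forall_2)

lemma frobenius_mat_hom: "frobenius_mat k \<in> hom (SL2 (GF_2_pow e)) (SL2 (GF_2_pow e))"
proof (rule homI)
  fix A B :: "gf2bar ^ 2 ^ 2"
  obtain p q r s p' q' r' s' where AB: "A = mat2 p q r s" "B = mat2 p' q' r' s'"
    by (metis mat2_cases)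
  show "frobenius_mat k (A \<otimes>\<^bsub>SL2 (GF_2_pow e)\<^esub> B) =
      frobenius_mat k A \<otimes>\<^bsub>SL2 (GF_2_pow e)\<^esub> frobenius_mat k B"
    by (simp add: AB gf2bar_add_pow power_mult_distrib)
  show "frobenius_mat k A \<in> carrier (SL2 (GF_2_pow e))" if "A \<in> carrier (SL2 (GF_2_pow e))"
  proof -
    have "(p * s + q * r) ^ 2 ^ k = 1"
      using that by (simp add: AB mat2_in_SL2)
    then show ?thesis
      using that by (auto simp: AB mat2_in_SL2 gf2bar_add_pow power_mult_distrib intro: GF_2_pow_power)
  qed
qed

lemma frobenius_mat_eq_1: "frobenius_mat k A = mat 1 \<Longrightarrow> A = mat 1"
proof -
  have *: "x ^ 2 ^ k = 1 \<Longrightarrow> x = 1" for x :: gf2bar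
    using gf2bar_add_pow[of x 1 k] gf2bar_add_eq_0[of x 1] by simp
  assume "frobenius_mat k A = mat 1"
  then show ?thesis
    by (cases A rule: mat2_cases) (auto simp: mat_1_mat2 dest: *)
qed

text \<open>Excludes duality: if the map subgroup were invariant under exchanging \<open>R0\<close>
  and \<open>R2\<close>, the exchange would descend to such a \<open>\<psi>\<close>.\<close>

lemma SL2_no_duality:
  assumes \<psi>: "\<psi> \<in> hom (SL2 (GF_2_pow e)) (SL2 (GF_2_pow e))"
    and ab: "a \<in> GF_2_pow e" "b \<in> GF_2_pow e" "a \<noteq> 0" "b \<noteq> 0"
    and swap: "\<psi> (upper a) = upper b" "\<psi> (upper b) = upper a" "\<psi> swap_mat = swap_mat"
    and b: "b = a ^ 2 ^ k" "b ^ 2 ^ k \<noteq> a"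
  shows False
proof -
  let ?F = "GF_2_pow e" and ?G = "SL2 (GF_2_pow e)"
  have mult: "\<psi> (A ** B) = \<psi> A ** \<psi> B" if "A \<in> carrier ?G" "B \<in> carrier ?G" for A B
    using hom_mult[OF \<psi> that] by simp
  have one: "\<psi> (mat 1) = mat 1"
    using group_hom.hom_one[of ?G ?G \<psi>] \<psi>
    by (simp add: group_hom_def group_hom_axioms_def group_SL2_GF)
  note GF = GF_2_pow_subfield[where e = e]
  note [simp] = GF
  have upper_SL2 [simp]: "upper x \<in> carrier ?G" if "x \<in> ?F" for x
    using that by (simp add: mat2_in_SL2)
  have swap_SL2 [simp]: "swap_mat \<in> carrier ?G"
    by (simp add: mat2_in_SL2)
  have closed [simp]: "A ** B \<in> carrier ?G" if "A \<in> carrier ?G" "B \<in> carrier ?G" for A B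
    using that group.is_monoid[OF group_SL2_GF] monoid.m_closed by fastforce
  \<comment> \<open>The centralizer of \<open>upper b\<close> consists of the unipotent upper triangular matrices.\<close>
  have "\<exists>y. \<psi> (upper x) = upper y" if "x \<in> ?F" for x
  proof -
    obtain p q r s where pqrs: "\<psi> (upper x) = mat2 p q r s" by (rule mat2_cases)
    have "\<psi> (upper x) \<in> carrier ?G"
      using that by (intro hom_in_carrier[OF \<psi>]) simp
    then have det: "p * s + q * r = 1"
      by (simp add: pqrs mat2_in_SL2)
    have "\<psi> (upper x ** upper a) = \<psi> (upper a ** upper x)"
      by (simp add: add.commute)
    then have "mat2 p q r s ** upper b = upper b ** mat2 p q r s"
      using that ab by (simp only: mult upper_SL2 swap pqrs)
    then have "r = 0" "s = p"
      using ab by (auto simp: add.commute)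
    moreover from this have "p = 1"
      using det gf2bar_square_inj[of p 1] by (simp add: power2_eq_square)
    ultimately show ?thesis
      using pqrs by auto
  qed
  then obtain \<phi> where \<phi>: "\<And>x. x \<in> ?F \<Longrightarrow> \<psi> (upper x) = upper (\<phi> x)"
    by metis
  have "\<phi> 1 = 1"
  proof -
    \<comment> \<open>\<open>upper 1 ** swap_mat\<close> has order three; transporting this relation
      by \<open>\<psi>\<close> pins down \<open>\<phi> 1\<close>.\<close>
    have "upper 1 ** swap_mat ** upper 1 ** swap_mat ** upper 1 ** swap_mat = (mat 1 :: gf2bar ^ 2 ^ 2)"
      by (simp add: mat_1_mat2)
    then have "\<psi> (upper 1 ** swap_mat ** upper 1 ** swap_mat ** upper 1 ** swap_mat) = mat 1"
      using one by metis
    then have "upper (\<phi> 1) ** swap_mat ** upper (\<phi> 1) ** swap_mat ** upper (\<phi> 1) ** swap_mat = mat 1"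
      by (simp only: mult closed upper_SL2 swap_SL2 GF \<phi> swap)
    then have "\<phi> 1 * \<phi> 1 + 1 = 0"
      by (simp add: mat_1_mat2)
    then show ?thesis
      using gf2bar_square_inj[of "\<phi> 1" 1] gf2bar_add_eq_0 by (simp add: power2_eq_square)
  qed
  \<comment> \<open>The matrix \<open>upper t ** swap_mat ** upper (1 / t) ** swap_mat ** upper t ** swap_mat\<close> is the
    diagonal matrix with entries \<open>t\<close> and \<open>1 / t\<close>.\<close>
  have square: "\<phi> (t ^ 2) = \<phi> t ^ 2" if t: "t \<in> ?F" "t \<noteq> 0" for t
  proof -
    define h where "h x y = upper x ** swap_mat ** upper y ** swap_mat ** upper x ** swap_mat" for x y :: gf2bar
    have h: "h x y = mat2 (x ^ 2 * y) (1 + x * y) (1 + x * y) y" for x y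
      by (simp add: h_def algebra_simps power2_eq_square)
    have inv_t: "inverse t \<in> ?F" and t2: "t ^ 2 \<in> ?F"
      using t by (simp_all add: power2_eq_square)
    have h_SL2: "h t (inverse t) \<in> carrier ?G"
    proof -
      have "h t (inverse t) = mat2 t 0 0 (inverse t)"
        using t by (simp add: h power2_eq_square)
      then show ?thesis
        using t by (simp add: mat2_in_SL2)
    qed
    have "\<psi> (h t (inverse t)) = h (\<phi> t) (\<phi> (inverse t))"
      unfolding h_def using t inv_t by (simp only: mult closed upper_SL2 swap_SL2 \<phi> swap)
    moreover have "h t (inverse t) ** upper 1 = upper (t ^ 2) ** h t (inverse t)"
      using t by (simp add: h power2_eq_square)
    then have "\<psi> (h t (inverse t)) ** \<psi> (upper 1) = \<psi> (upper (t ^ 2)) ** \<psi> (h t (inverse t))"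
      using mult[OF h_SL2 upper_SL2[of 1]] mult[OF upper_SL2[OF t2] h_SL2] by simp
    ultimately have "h (\<phi> t) (\<phi> (inverse t)) ** upper 1 = upper (\<phi> (t ^ 2)) ** h (\<phi> t) (\<phi> (inverse t))"
      using \<phi>[of 1] \<phi>[OF t2] \<open>\<phi> 1 = 1\<close> by simp
    \<comment> \<open>These compare the lower right and the upper right entries of the two
      products.\<close>
    then have *: "1 + \<phi> t * \<phi> (inverse t) = 0"
      "\<phi> t ^ 2 * \<phi> (inverse t) + (1 + \<phi> t * \<phi> (inverse t)) =
       (1 + \<phi> t * \<phi> (inverse t)) + \<phi> (t ^ 2) * \<phi> (inverse t)"
      by (simp_all add: h)
    from *(1) have "\<phi> (inverse t) \<noteq> 0" by auto
    with * show ?thesis by simp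
  qed
  have power: "\<phi> (a ^ 2 ^ i) = \<phi> a ^ 2 ^ i" for i
  proof (induction i)
    case (Suc i)
    have "\<phi> ((a ^ 2 ^ i) ^ 2) = \<phi> (a ^ 2 ^ i) ^ 2"
      using ab by (intro square GF_2_pow_power) auto
    with Suc show ?case
      by (simp add: mult.commute flip: power_mult)
  qed simp
  have "\<phi> a = b" "\<phi> b = a"
    using \<phi>[OF ab(1)] \<phi>[OF ab(2)] swap by auto
  with power[of k] b show False by simp
qed

section \<open>Descending and lifting symmetries along a homomorphism\<close>

text \<open>\<open>h\<close> applies g to a chosen preimage under f; the kernel inclusion makes the
  choice irrelevant.\<close>

lemma hom_factor_surj:
  assumes "group G" "group H" "f \<in> hom G H" "f ` carrier G = carrier H" "g \<in> hom G K" "group K"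
    and ker: "kernel G H f \<subseteq> kernel G K g"
  obtains h where "h \<in> hom H K" "\<And>x. x \<in> carrier G \<Longrightarrow> h (f x) = g x"
proof -
  interpret f: group_hom G H f
    using assms by (simp add: group_hom_def group_hom_axioms_def)
  interpret g: group_hom G K g
    using assms by (simp add: group_hom_def group_hom_axioms_def)
  have eq: "g x = g y" if "x \<in> carrier G" "y \<in> carrier G" "f x = f y" for x y
  proof -
    have "x \<otimes>\<^bsub>G\<^esub> inv\<^bsub>G\<^esub> y \<in> kernel G H f"
      using that by (simp add: kernel_def)
    with ker have "x \<otimes>\<^bsub>G\<^esub> inv\<^bsub>G\<^esub> y \<in> kernel G K g" by blast
    then have "g x \<otimes>\<^bsub>K\<^esub> inv\<^bsub>K\<^esub> g y = \<one>\<^bsub>K\<^esub>"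
      using that by (simp add: kernel_def)
    then show ?thesis
      using that g.H.inv_equality[of "g x" "inv\<^bsub>K\<^esub> g y"] by simp
  qed
  define h where "h y = g (inv_into (carrier G) f y)" for y
  have h: "h (f x) = g x" if "x \<in> carrier G" for x
    unfolding h_def using that by (intro eq inv_into_into f_inv_into_f) auto
  have "h \<in> hom H K"
  proof (rule homI)
    fix y z assume "y \<in> carrier H" "z \<in> carrier H"
    then obtain y' z' where yz: "y' \<in> carrier G" "z' \<in> carrier G" "y = f y'" "z = f z'"
      using assms(4) by blast
    show "h y \<in> carrier K"
      by (simp add: yz h)
    show "h (y \<otimes>\<^bsub>H\<^esub> z) = h y \<otimes>\<^bsub>K\<^esub> h z"
      using h[of "y' \<otimes>\<^bsub>G\<^esub> z'"] by (simp add: yz h)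
  qed
  with h that show ?thesis by blast
qed

text \<open>Agreement on generators gives
  \<open>\<Phi> \<circ> \<sigma> = \<alpha> \<circ> \<Phi>\<close> on all of \<open>Gamma\<close>.
  As \<open>\<alpha>\<close> has trivial kernel, \<open>\<sigma>\<close> preserves membership in the
  kernel of \<open>\<Phi>\<close> in both directions.\<close>

lemma Gamma_image_kernel:
  assumes G: "Group.group G" and \<Phi>: "\<Phi> \<in> hom Gamma G"
    and \<sigma>: "\<sigma> \<in> hom Gamma Gamma" "bij_betw \<sigma> (carrier Gamma) (carrier Gamma)"
    and \<alpha>: "\<alpha> \<in> hom G G" "\<And>x. x \<in> carrier G \<Longrightarrow> \<alpha> x = \<one>\<^bsub>G\<^esub> \<Longrightarrow> x = \<one>\<^bsub>G\<^esub>"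
    and eq: "\<Phi> (\<sigma> R0) = \<alpha> (\<Phi> R0)" "\<Phi> (\<sigma> R1) = \<alpha> (\<Phi> R1)" "\<Phi> (\<sigma> R2) = \<alpha> (\<Phi> R2)"
  shows "\<sigma> ` kernel Gamma G \<Phi> = kernel Gamma G \<Phi>"
proof -
  have hom: "\<Phi> \<circ> \<sigma> \<in> hom Gamma G" "\<alpha> \<circ> \<Phi> \<in> hom Gamma G"
    using hom_compose \<Phi> \<sigma>(1) \<alpha>(1) by blast+
  have "\<Phi> (\<sigma> x) = \<alpha> (\<Phi> x)" if "x \<in> carrier Gamma" for x
    using Gamma_hom_eqI[OF G hom _ _ _ that] eq by simp
  moreover have "\<alpha> \<one>\<^bsub>G\<^esub> = \<one>\<^bsub>G\<^esub>"
    using hom_one[OF \<alpha>(1) G G] .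
  ultimately have "\<Phi> (\<sigma> x) = \<one>\<^bsub>G\<^esub> \<longleftrightarrow> \<Phi> x = \<one>\<^bsub>G\<^esub>" if "x \<in> carrier Gamma" for x
    using that \<alpha>(2) hom_in_carrier[OF \<Phi>] by metis
  then have kernel_iff: "\<sigma> x \<in> kernel Gamma G \<Phi> \<longleftrightarrow> x \<in> kernel Gamma G \<Phi>" if "x \<in> carrier Gamma" for x
    using that hom_in_carrier[OF \<sigma>(1)] by (simp add: kernel_def)
  have sub: "kernel Gamma G \<Phi> \<subseteq> carrier Gamma"
    by (auto simp: kernel_def)
  show ?thesis
  proof (intro equalityI subsetI)
    fix y assume "y \<in> \<sigma> ` kernel Gamma G \<Phi>"
    then show "y \<in> kernel Gamma G \<Phi>"
      using kernel_iff sub by blast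
  next
    fix y assume y: "y \<in> kernel Gamma G \<Phi>"
    then obtain x where "x \<in> carrier Gamma" "y = \<sigma> x"
      using sub \<sigma>(2) unfolding bij_betw_def by blast
    with y kernel_iff show "y \<in> \<sigma> ` kernel Gamma G \<Phi>" by blast
  qed
qed

text \<open>The classical duality of maps; it is bijective because its square fixes the
  generators.\<close>

lemma Gamma_swap:
  obtains d where "d \<in> hom Gamma Gamma" "bij_betw d (carrier Gamma) (carrier Gamma)"
    "d R0 = R2" "d R1 = R1" "d R2 = R0" "d R02 = R02"
    "\<And>x. x \<in> carrier Gamma \<Longrightarrow> d (d x) = x"
proof -
  interpret Group.group Gamma by (rule group_Gamma)
  obtain d where d: "d \<in> hom Gamma Gamma" "d R0 = R2" "d R1 = R1" "d R2 = R0"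
    by (rule Gamma_hom_exists[of Gamma R2 R1 R0]) (simp_all add: Gamma_relations Gamma_commute is_group)
  have dd: "d (d x) = x" if "x \<in> carrier Gamma" for x
  proof -
    have "(d \<circ> d) x = id x"
    proof (rule Gamma_hom_eqI[OF is_group, of "d \<circ> d" id])
      show "d \<circ> d \<in> hom Gamma Gamma"
        using d(1) d(1) by (rule Group.hom_compose)
    qed (use that d in \<open>auto simp: hom_def\<close>)
    then show ?thesis by simp
  qed
  moreover have "bij_betw d (carrier Gamma) (carrier Gamma)"
    using dd hom_in_carrier[OF d(1)] by (intro bij_betw_byWitness[of _ d]) auto
  moreover have "d R02 = R02"
    using d by (simp add: hom_mult Gamma_commute)
  ultimately show ?thesis
    using that d by blast
qed

section \<open>The map and its two-element orbit\<close>

theorem theorem3p2: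
  fixes e :: nat
  assumes "e > 0" and "3 dvd e"
  shows "\<exists>M. class_III M \<and> map_automorphism_group M \<cong> SL2 (GF_2_pow e)"
proof -
  obtain m where e: "e = 3 * m" using assms(2) by (auto elim: dvdE)
  then have m: "m > 0" using assms(1) by simp
  let ?G = "SL2 (GF_2_pow e)" and ?C = "carrier Gamma"
  obtain a where a: "a \<in> GF_2_pow e" "a + a ^ 2 ^ m = (a ^ 2 ^ m) ^ 2 ^ m"
    "\<And>j. 0 < j \<Longrightarrow> j < e \<Longrightarrow> a ^ 2 ^ j \<noteq> a"
    using ex_trace_zero_generator[OF m] unfolding e by blast
  define b where "b = a ^ 2 ^ m"
  \<comment> \<open>Raising to the power 2^m cycles a, b, a + b, matching the triality on
    \<open>R0\<close>, \<open>R2\<close>, \<open>R02\<close>.\<close>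
  have "b \<in> GF_2_pow e" "b ^ 2 ^ m = a + b"
    using a(1,2) by (simp_all add: b_def GF_2_pow_power)
  moreover from this have "(a + b) ^ 2 ^ m = a"
    by (simp add: gf2bar_add_pow add_ac flip: b_def)
  ultimately have b: "b \<in> GF_2_pow e" "b ^ 2 ^ m = a + b" "(a + b) ^ 2 ^ m = a" .
  \<comment> \<open>Period 1 is excluded to get \<open>a \<noteq> 0\<close>, and period m to get
    \<open>a \<noteq> b\<close>.\<close>
  have ab: "a \<noteq> 0" "b \<noteq> 0" "a \<noteq> b" "a + b \<noteq> 0"
    using a(3)[of 1] a(3)[of m] m by (auto simp: b_def e gf2bar_add_eq_0)
  have gens: "upper a \<in> carrier ?G" "swap_mat \<in> carrier ?G" "upper b \<in> carrier ?G"
    using a b by (simp_all add: mat2_in_SL2 GF_2_pow_subfield)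
  interpret G: Group.group ?G by (rule group_SL2_GF)
  interpret Gam: Group.group Gamma by (rule group_Gamma)
  obtain \<Phi> where \<Phi>: "\<Phi> \<in> hom Gamma ?G" "\<Phi> R0 = upper a" "\<Phi> R1 = swap_mat" "\<Phi> R2 = upper b"
    by (rule Gamma_hom_exists[OF G.is_group gens]) (simp_all add: mat_1_mat2)
  interpret \<Phi>: group_hom Gamma ?G \<Phi>
    using \<Phi>(1) by unfold_locales
  have \<Phi>02: "\<Phi> R02 = upper (a + b)"
    by (subst \<Phi>.hom_mult) (simp_all add: \<Phi>(2-4) add.commute)
  have "\<Phi> ` ?C = carrier ?G"
  proof (rule SL2_GF_generation[OF assms(1), where a = a and b = b])
    show "A ** B \<in> \<Phi> ` ?C" if AB: "A \<in> \<Phi> ` ?C" "B \<in> \<Phi> ` ?C" for A B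
    proof -
      obtain x y where xy: "x \<in> ?C" "y \<in> ?C" "A = \<Phi> x" "B = \<Phi> y"
        using AB by blast
      then have "A ** B = \<Phi> (x \<otimes>\<^bsub>Gamma\<^esub> y)"
        by simp
      with xy show ?thesis by blast
    qed
    show "F = GF_2_pow e" if "F \<subseteq> GF_2_pow e" "a \<in> F" "0 \<in> F" "1 \<in> F"
      "\<And>x y. x \<in> F \<Longrightarrow> y \<in> F \<Longrightarrow> x + y \<in> F \<and> x * y \<in> F" for F
      using generator_GF_2_pow[OF assms(1) a(1,3)] that by blast
    show "upper a \<in> \<Phi> ` ?C" "upper b \<in> \<Phi> ` ?C" "swap_mat \<in> \<Phi> ` ?C"
      using \<Phi>(2-4) by (metis gamma_class_closed imageI)+
    show "\<Phi> ` ?C \<subseteq> carrier ?G" by auto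
  qed (use ab in auto)
  note surj = this
  define M where "M = kernel Gamma ?G \<Phi>"
  have M: "x \<in> M \<longleftrightarrow> x \<in> ?C \<and> \<Phi> x = mat 1" for x
    by (simp add: M_def kernel_def)
  have "map_automorphism_group M \<cong> ?G"
    unfolding map_automorphism_group_def M_def by (rule \<Phi>.FactGroup_iso[OF surj])
  moreover have "regular_map_subgroup M"
    unfolding regular_map_subgroup_def
  proof (intro conjI ballI notI)
    show "M \<lhd> Gamma"
      unfolding M_def by (rule \<Phi>.normal_kernel)
    fix x r assume x: "x \<in> ?C" and r: "r \<in> {R0, R1, R2, R02}"
      and "x \<otimes>\<^bsub>Gamma\<^esub> r \<otimes>\<^bsub>Gamma\<^esub> inv\<^bsub>Gamma\<^esub> x \<in> M"
    moreover have "r \<in> ?C" using r by auto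
    ultimately have "\<Phi> x \<otimes>\<^bsub>?G\<^esub> \<Phi> r \<otimes>\<^bsub>?G\<^esub> inv\<^bsub>?G\<^esub> \<Phi> x = \<one>\<^bsub>?G\<^esub>"
      by (simp add: M del: SL2_mult)
    then have "\<Phi> x \<otimes>\<^bsub>?G\<^esub> \<Phi> r = \<Phi> x \<otimes>\<^bsub>?G\<^esub> \<one>\<^bsub>?G\<^esub>"
      using x \<open>r \<in> ?C\<close> G.inv_equality[of "\<Phi> x \<otimes>\<^bsub>?G\<^esub> \<Phi> r" "inv\<^bsub>?G\<^esub> \<Phi> x"]
      by (simp del: SL2_mult SL2_one)
    then have "\<Phi> r = \<one>\<^bsub>?G\<^esub>"
      using x \<open>r \<in> ?C\<close> by (simp del: SL2_mult SL2_one)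
    with r show False
      using \<Phi> \<Phi>02 ab by (auto simp: mat_1_mat2 gf2bar_add_eq_0)
  qed
  moreover have "card (map_orbit M) = 2"
  proof -
    \<comment> \<open>Cyclic permutations of the three involutions are realised on the matrices by
      the entrywise powers 2^k with k = 0, m, 2m, so they preserve \<open>M\<close>.\<close>
    have even: "\<sigma> ` M = M"
      if \<sigma>: "\<sigma> \<in> hom Gamma Gamma" "bij_betw \<sigma> ?C ?C" "\<sigma> R1 = R1"
        and cases: "(\<sigma> R0, \<sigma> R2) \<in> {(R0, R2), (R2, R02), (R02, R0)}" for \<sigma>
    proof -
      have "\<exists>k. \<Phi> (\<sigma> R0) = upper (a ^ 2 ^ k) \<and> \<Phi> (\<sigma> R2) = upper (b ^ 2 ^ k)"
      proof -
        consider "\<sigma> R0 = R0" "\<sigma> R2 = R2" | "\<sigma> R0 = R2" "\<sigma> R2 = R02" | "\<sigma> R0 = R02" "\<sigma> R2 = R0"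
          using cases by auto
        then show ?thesis
        proof cases
          case 1
          then show ?thesis by (intro exI[of _ 0]) (simp add: \<Phi>(2,4))
        next
          case 2
          then show ?thesis by (intro exI[of _ m]) (simp only: \<Phi>(2,4) \<Phi>02 b(2) flip: b_def)
        next
          case 3
          have "x ^ 2 ^ (m + m) = (x ^ 2 ^ m) ^ 2 ^ m" for x :: gf2bar
            by (simp add: power_add power_mult)
          with 3 show ?thesis
            by (intro exI[of _ "m + m"]) (simp only: \<Phi>(2,4) \<Phi>02 b(2,3) flip: b_def)
        qed
      qed
      then obtain k where "\<Phi> (\<sigma> R0) = upper (a ^ 2 ^ k)" "\<Phi> (\<sigma> R2) = upper (b ^ 2 ^ k)"
        by blast
      then show ?thesis
        unfolding M_def using \<Phi> \<sigma>(3) frobenius_mat_eq_1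
        by (intro Gamma_image_kernel[OF G.is_group \<Phi>(1) \<sigma>(1,2) frobenius_mat_hom[of k]]) auto
    qed
    obtain d where d: "d \<in> hom Gamma Gamma" "bij_betw d ?C ?C"
      "d R0 = R2" "d R1 = R1" "d R2 = R0" "d R02 = R02" "\<And>x. x \<in> ?C \<Longrightarrow> d (d x) = x"
      using Gamma_swap by blast
    have neq: "R0 \<noteq> R2"
      using \<Phi>(2,4) ab(3) by auto
    have orbit_subset: "\<sigma> ` M \<in> {M, d ` M}" if "\<sigma> \<in> Sigma_ops" for \<sigma>
    proof -
      have \<sigma>: "\<sigma> \<in> hom Gamma Gamma" "bij_betw \<sigma> ?C ?C" "\<sigma> R1 = R1"
        "\<sigma> ` {R0, R2, R02} = {R0, R2, R02}"
        using that by (auto simp: Sigma_ops_def auto_def Bij_def)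
      have "\<sigma> R0 \<noteq> \<sigma> R2"
        using \<sigma>(2) neq by (auto simp: bij_betw_def inj_on_eq_iff[where A = ?C])
      moreover have "\<sigma> R0 \<in> {R0, R2, R02}" "\<sigma> R2 \<in> {R0, R2, R02}"
        using \<sigma>(4) by blast+
      ultimately consider "(\<sigma> R0, \<sigma> R2) \<in> {(R0, R2), (R2, R02), (R02, R0)}"
        | "(\<sigma> R0, \<sigma> R2) \<in> {(R2, R0), (R02, R2), (R0, R02)}"
        by auto
      then show ?thesis
      proof cases
        case 1
        with even[OF \<sigma>(1-3)] show ?thesis by simp
      next
        case 2
        \<comment> \<open>Composing an odd permutation with the transposition \<open>d\<close> gives
          an even one; as \<open>d\<close> is an involution, \<open>\<sigma>\<close> sends
          \<open>M\<close> to its image under \<open>d\<close>.\<close>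
        have "(d \<circ> \<sigma>) ` M = M"
        proof (rule even)
          show "d \<circ> \<sigma> \<in> hom Gamma Gamma"
            using \<sigma>(1) d(1) by (rule Group.hom_compose)
          show "bij_betw (d \<circ> \<sigma>) ?C ?C"
            using \<sigma>(2) d(2) by (rule bij_betw_trans)
        qed (use 2 \<sigma>(3) d in auto)
        then have "d ` (d ` \<sigma> ` M) = d ` M"
          by (simp add: image_comp)
        moreover have "d ` d ` \<sigma> ` M = \<sigma> ` M"
          using d(7) hom_in_carrier[OF \<sigma>(1)] M by (force simp: image_comp)
        ultimately show ?thesis by simp
      qed
    qed
    \<comment> \<open>Elements of \<open>auto\<close> are extensional on the carrier, hence the
      restriction.\<close>
    have "restrict d ?C \<in> Sigma_ops"
      using d hom_mult[OF d(1)] hom_in_carrier[OF d(1)]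
      by (auto simp: Sigma_ops_def auto_def Bij_def hom_def cong: bij_betw_cong)
    moreover have "restrict d ?C ` M = d ` M"
      using M by (intro image_cong) auto
    moreover have "restrict id ?C \<in> Sigma_ops"
      using bij_betw_id[of ?C]
      by (auto simp: Sigma_ops_def auto_def Bij_def hom_def id_def cong: bij_betw_cong)
    moreover have "restrict id ?C ` M = M"
      using M by force
    ultimately have "{M, d ` M} \<subseteq> map_orbit M"
      unfolding map_orbit_def by (metis empty_subsetI imageI insert_subset)
    moreover have "map_orbit M \<subseteq> {M, d ` M}"
      unfolding map_orbit_def using orbit_subset by blast
    ultimately have orbit: "map_orbit M = {M, d ` M}" by blast
    have "d ` M \<noteq> M"
    proof
      assume dM: "d ` M = M"
      have "\<Phi> \<circ> d \<in> hom Gamma ?G"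
        using d(1) \<Phi>(1) by (rule Group.hom_compose)
      moreover have "M \<subseteq> kernel Gamma ?G (\<Phi> \<circ> d)"
        using dM M by (auto simp: kernel_def)
      ultimately obtain \<psi> where \<psi>: "\<psi> \<in> hom ?G ?G" "\<And>x. x \<in> ?C \<Longrightarrow> \<psi> (\<Phi> x) = (\<Phi> \<circ> d) x"
        using hom_factor_surj[OF Gam.is_group G.is_group \<Phi>(1) surj _ G.is_group] unfolding M_def by blast
      \<comment> \<open>The exponent is k = m, and \<open>b ^ 2 ^ m = a + b\<close> differs from a
        because b is nonzero.\<close>
      show False
        using \<psi>(2)[of R0] \<psi>(2)[of R1] \<psi>(2)[of R2] \<Phi> d ab b
        by (intro SL2_no_duality[OF \<psi>(1) a(1) b(1) ab(1,2) _ _ _ b_def]) auto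
    qed
    then show ?thesis
      by (simp add: orbit)
  qed
  ultimately show ?thesis
    unfolding class_III_def by blast
qed

end
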